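(* Let $X$ be a finite nonempty set of cardinality $n$ and let $N=\binom{n}{2}$. The number of different principal left ideals in $\mathcal{M}(X)$ is $$\sum_{d=1}^n\binom{n}{d}\sum_{k=0}^{N}\binom{N+n-d}{k}.$$
   Context: $\mathcal{M}(X)=X^{X\times X}$ is the set of all binary operations on $X$, a monoid under $\triangleright$ defined by $a(\circ\triangleright\ast)b=(a\circ b)\ast(b\circ a)$ for all $a,b\in X$, with identity $a\circ_{lz}b=a$. The principal left ideal generated by $\ast$ is $\{\circ\triangleright\ast : \circ\in\mathcal{M}(X)\}$. *)

theory Defs
  imports "HOL-Algebra.Group" "HOL-Library.FuncSet"
begin

text \<open>
  A binary operation on \<open>X\<close> is an extensional function \<open>X \<times> X \<rightarrow> X\<close>: its value is
  \<open>undefined\<close> outside \<open>X \<times> X\<close>, so equality of functions is equality of operations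
  on \<open>X\<close>.
\<close>

definition bin_ops :: "'a set \<Rightarrow> ('a \<times> 'a \<Rightarrow> 'a) set" where
  "bin_ops X = (X \<times> X) \<rightarrow>\<^sub>E X"

definition op_mult :: "'a set \<Rightarrow> ('a \<times> 'a \<Rightarrow> 'a) \<Rightarrow> ('a \<times> 'a \<Rightarrow> 'a) \<Rightarrow> ('a \<times> 'a \<Rightarrow> 'a)" where
  "op_mult X f g = (\<lambda>(a, b) \<in> X \<times> X. g (f (a, b), f (b, a)))"

definition left_zero_op :: "'a set \<Rightarrow> ('a \<times> 'a \<Rightarrow> 'a)" where
  "left_zero_op X = (\<lambda>(a, b) \<in> X \<times> X. a)"

definition op_monoid :: "'a set \<Rightarrow> ('a \<times> 'a \<Rightarrow> 'a) monoid" where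
  "op_monoid X = \<lparr>carrier = bin_ops X, mult = op_mult X, one = left_zero_op X\<rparr>"

definition principal_left_ideal :: "('b, 'c) monoid_scheme \<Rightarrow> 'b \<Rightarrow> 'b set" where
  "principal_left_ideal M g = {f \<otimes>\<^bsub>M\<^esub> g | f. f \<in> carrier M}"

lemma op_mult_apply:
  assumes "a \<in> X" "b \<in> X"
  shows "op_mult X f g (a, b) = g (f (a, b), f (b, a))"
  using assms by (simp add: op_mult_def)

lemma monoid_op_monoid: "monoid (op_monoid X)"
proof
  fix f g h
  assume "f \<in> carrier (op_monoid X)" "g \<in> carrier (op_monoid X)"
  then have f: "f \<in> (X \<times> X) \<rightarrow>\<^sub>E X" and g: "g \<in> (X \<times> X) \<rightarrow>\<^sub>E X"
    by (auto simp: op_monoid_def bin_ops_def)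
  have fX: "f (a, b) \<in> X" if "a \<in> X" "b \<in> X" for a b
    using PiE_mem[OF f] that by blast
  have gX: "g (a, b) \<in> X" if "a \<in> X" "b \<in> X" for a b
    using PiE_mem[OF g] that by blast
  show "f \<otimes>\<^bsub>op_monoid X\<^esub> g \<in> carrier (op_monoid X)"
    by (auto simp: op_monoid_def bin_ops_def op_mult_def fX gX)
  show "f \<otimes>\<^bsub>op_monoid X\<^esub> g \<otimes>\<^bsub>op_monoid X\<^esub> h = f \<otimes>\<^bsub>op_monoid X\<^esub> (g \<otimes>\<^bsub>op_monoid X\<^esub> h)"
    by (auto simp: op_monoid_def op_mult_def fX fun_eq_iff restrict_def)
next
  show "\<one>\<^bsub>op_monoid X\<^esub> \<in> carrier (op_monoid X)"
    by (auto simp: op_monoid_def bin_ops_def left_zero_op_def)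
next
  fix f
  assume "f \<in> carrier (op_monoid X)"
  then have f: "f \<in> (X \<times> X) \<rightarrow>\<^sub>E X"
    by (auto simp: op_monoid_def bin_ops_def)
  have fX: "f (a, b) \<in> X" if "a \<in> X" "b \<in> X" for a b
    using PiE_mem[OF f] that by blast
  have fu: "f p = undefined" if "p \<notin> X \<times> X" for p
    using PiE_arb[OF f that] .
  show "\<one>\<^bsub>op_monoid X\<^esub> \<otimes>\<^bsub>op_monoid X\<^esub> f = f"
    by (auto simp: op_monoid_def op_mult_def left_zero_op_def fun_eq_iff restrict_def fu)
  show "f \<otimes>\<^bsub>op_monoid X\<^esub> \<one>\<^bsub>op_monoid X\<^esub> = f"
    by (auto simp: op_monoid_def op_mult_def left_zero_op_def fun_eq_iff restrict_def fX fu)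
qed

end

theory Submission
  imports Defs
begin

text \<open>
  An operation \<open>h\<close> lies in the left ideal of \<open>g\<close> iff every square \<open>h (a, a)\<close> is a square of \<open>g\<close>
  and every unordered pair \<open>{h (a, b), h (b, a)}\<close> is of the form \<open>{g (x, y), g (y, x)}\<close>.
  So the ideal amounts to the set \<open>D\<close> of squares of \<open>g\<close> together with the set \<open>F\<close> of those
  unordered pairs that are not singletons from \<open>D\<close>. As \<open>F\<close> is produced by
  the \<open>N\<close> two-element subsets of \<open>X\<close>, the possible \<open>F\<close> are exactly the sets of at most \<open>N\<close>
  elements chosen among the \<open>N\<close> two-element subsets and the \<open>n - |D|\<close> remaining singletons.
\<close>

section \<open>Squares and value pairs as invariants of a left ideal\<close>

definition squares :: "'a set \<Rightarrow> ('a \<times> 'a \<Rightarrow> 'a) \<Rightarrow> 'a set" where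
  "squares X g = (\<lambda>x. g (x, x)) ` X"

definition value_pairs :: "'a set \<Rightarrow> ('a \<times> 'a \<Rightarrow> 'a) \<Rightarrow> 'a set set" where
  "value_pairs X g = (\<lambda>(x, y). {g (x, y), g (y, x)}) ` (X \<times> X)"

text \<open>Singletons of squares already arise on the diagonal. What is left can only come from
  arguments \<open>x \<noteq> y\<close>, which is what makes the bound by the number of two-element
  subsets possible.\<close>

definition new_pairs :: "'a set \<Rightarrow> ('a \<times> 'a \<Rightarrow> 'a) \<Rightarrow> 'a set set" where
  "new_pairs X g = value_pairs X g - (\<lambda>d. {d}) ` squares X g"

definition two_subsets :: "'a set \<Rightarrow> 'a set set" where
  "two_subsets X = {A. A \<subseteq> X \<and> card A = 2}"

definition free_pairs :: "'a set \<Rightarrow> 'a set \<Rightarrow> 'a set set" where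
  "free_pairs X D = two_subsets X \<union> (\<lambda>u. {u}) ` (X - D)"

lemma bin_ops_mem: "g \<in> bin_ops X \<Longrightarrow> a \<in> X \<Longrightarrow> b \<in> X \<Longrightarrow> g (a, b) \<in> X"
  unfolding bin_ops_def by (blast dest: PiE_mem)

lemma value_pairs_eq: "value_pairs X g = new_pairs X g \<union> (\<lambda>d. {d}) ` squares X g"
  by (auto simp: new_pairs_def value_pairs_def squares_def image_iff)

text \<open>For \<open>a \<noteq> b\<close> the values \<open>f (a, b)\<close> and
  \<open>f (b, a)\<close> can be chosen independently, so the condition splits over unordered pairs.
  On the diagonal they coincide; squares need their own condition because a singleton value pair of
  \<open>g\<close> may come from \<open>x \<noteq> y\<close>.\<close>

lemma mem_principal_left_ideal_iff:
  assumes h: "h \<in> bin_ops X"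
  shows "h \<in> principal_left_ideal (op_monoid X) g
    \<longleftrightarrow> squares X h \<subseteq> squares X g \<and> value_pairs X h \<subseteq> value_pairs X g"
proof
  assume "h \<in> principal_left_ideal (op_monoid X) g"
  then obtain f where f: "f \<in> bin_ops X" and hf: "h = op_mult X f g"
    by (auto simp: principal_left_ideal_def op_monoid_def)
  have "squares X h \<subseteq> squares X g"
    by (auto simp: squares_def hf op_mult_apply bin_ops_mem[OF f])
  moreover have "value_pairs X h \<subseteq> value_pairs X g"
  proof
    fix A assume "A \<in> value_pairs X h"
    then obtain a b where "a \<in> X" "b \<in> X" "A = {h (a, b), h (b, a)}"
      by (auto simp: value_pairs_def)
    then show "A \<in> value_pairs X g"
      unfolding value_pairs_def
      by (intro image_eqI[of _ _ "(f (a, b), f (b, a))"])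
        (auto simp: hf op_mult_apply bin_ops_mem[OF f])
  qed
  ultimately show "squares X h \<subseteq> squares X g \<and> value_pairs X h \<subseteq> value_pairs X g" ..
next
  assume sub: "squares X h \<subseteq> squares X g \<and> value_pairs X h \<subseteq> value_pairs X g"
  have "\<forall>a\<in>X. \<exists>c. c \<in> X \<and> h (a, a) = g (c, c)"
    using sub by (auto simp: squares_def)
  then obtain c where c: "\<And>a. a \<in> X \<Longrightarrow> c a \<in> X \<and> h (a, a) = g (c a, c a)"
    by metis
  have ex: "\<exists>x y. x \<in> X \<and> y \<in> X \<and> h (a, b) = g (x, y) \<and> h (b, a) = g (y, x)"
    if "a \<in> X" "b \<in> X" for a b
  proof -
    have "{h (a, b), h (b, a)} \<in> value_pairs X g"
      using sub that by (auto simp: value_pairs_def)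
    then obtain x y where "x \<in> X" "y \<in> X" "{h (a, b), h (b, a)} = {g (x, y), g (y, x)}"
      by (auto simp: value_pairs_def)
    \<comment> \<open>If the two doubletons match crosswise, exchanging \<open>x\<close> and
      \<open>y\<close> gives the required order.\<close>
    then show ?thesis
      by (auto simp: doubleton_eq_iff)
  qed
  text \<open>The preimages for \<open>(a, b)\<close> and \<open>(b, a)\<close> must be swaps of each other, so one
    representative \<open>r\<close> of \<open>{a, b}\<close> decides for both.\<close>
  define r where "r A = (SOME x. x \<in> A)" for A :: "'a set"
  have r: "r {a, b} = a \<or> r {a, b} = b" for a b
    using someI[of "\<lambda>x. x \<in> {a, b}" a] by (auto simp: r_def)
  obtain s t where st: "\<And>a b. a \<in> X \<Longrightarrow> b \<in> X \<Longrightarrow>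
      s a b \<in> X \<and> t a b \<in> X \<and> h (a, b) = g (s a b, t a b) \<and> h (b, a) = g (t a b, s a b)"
    using ex by metis
  \<comment> \<open>The diagonal uses \<open>c\<close>, since \<open>s a a\<close> and
    \<open>t a a\<close> may differ.\<close>
  define f where "f = (\<lambda>(a, b) \<in> X \<times> X.
    if a = b then c a else if r {a, b} = a then s a b else t b a)"
  have "f \<in> bin_ops X"
    unfolding bin_ops_def f_def by (rule restrict_PiE_iff[THEN iffD2]) (simp add: c st split: prod.split)
  moreover have "h = op_mult X f g"
  proof (rule extensionalityI)
    show "h \<in> extensional (X \<times> X)" using h by (auto simp: bin_ops_def PiE_def)
    show "op_mult X f g \<in> extensional (X \<times> X)" by (simp add: op_mult_def)
    fix p assume "p \<in> X \<times> X"
    then obtain a b where p: "p = (a, b)" "a \<in> X" "b \<in> X" by auto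
    have ba: "r {b, a} = r {a, b}" by (simp add: insert_commute)
    have "h (a, b) = g (f (a, b), f (b, a))"
    proof (cases "a = b")
      case True
      then show ?thesis using p c[of a] by (simp add: f_def)
    next
      case False
      show ?thesis
      proof (cases "r {a, b} = a")
        case True
        then have "f (a, b) = s a b" "f (b, a) = t a b"
          using p ba \<open>a \<noteq> b\<close> by (simp_all add: f_def)
        then show ?thesis using p st[of a b] by metis
      next
        case False
        then have "f (a, b) = t b a" "f (b, a) = s b a"
          using p ba \<open>a \<noteq> b\<close> r[of a b] by (simp_all add: f_def)
        then show ?thesis using p st[of b a] by metis
      qed
    qed
    then show "h p = op_mult X f g p"
      using p by (simp add: op_mult_apply)
  qed
  ultimately show "h \<in> principal_left_ideal (op_monoid X) g"
    by (auto simp: principal_left_ideal_def op_monoid_def)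
qed

text \<open>Each operation satisfies the membership criterion for itself, so equal ideals contain
  each other's generators and force both inclusions. Conversely, the criterion depends only on the
  two invariants, by \<open>value_pairs_eq\<close>.\<close>

lemma principal_left_ideal_eq_iff:
  assumes "g \<in> bin_ops X" "h \<in> bin_ops X"
  shows "principal_left_ideal (op_monoid X) g = principal_left_ideal (op_monoid X) h
    \<longleftrightarrow> (squares X g, new_pairs X g) = (squares X h, new_pairs X h)"
proof
  assume "principal_left_ideal (op_monoid X) g = principal_left_ideal (op_monoid X) h"
  then have "squares X g = squares X h \<and> value_pairs X g = value_pairs X h"
    using mem_principal_left_ideal_iff[OF assms(1), of g] mem_principal_left_ideal_iff[OF assms(1), of h]
      mem_principal_left_ideal_iff[OF assms(2), of g] mem_principal_left_ideal_iff[OF assms(2), of h]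
    by auto
  then show "(squares X g, new_pairs X g) = (squares X h, new_pairs X h)"
    by (simp add: new_pairs_def)
next
  assume eq: "(squares X g, new_pairs X g) = (squares X h, new_pairs X h)"
  have sub: "principal_left_ideal (op_monoid X) k \<subseteq> bin_ops X" if "k \<in> bin_ops X" for k
    using that monoid.m_closed[OF monoid_op_monoid, of _ X k]
    by (auto simp: principal_left_ideal_def) (auto simp: op_monoid_def)
  have "k \<in> principal_left_ideal (op_monoid X) g \<longleftrightarrow> k \<in> principal_left_ideal (op_monoid X) h"
    if "k \<in> bin_ops X" for k
    using eq by (simp add: mem_principal_left_ideal_iff[OF that] value_pairs_eq)
  then show "principal_left_ideal (op_monoid X) g = principal_left_ideal (op_monoid X) h"
    using sub assms by blast
qed

section \<open>The invariants that occur\<close>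

lemma
  assumes "finite X"
  shows finite_two_subsets: "finite (two_subsets X)"
    and card_two_subsets: "card (two_subsets X) = card X choose 2"
  using assms by (auto simp: two_subsets_def n_subsets)

lemma
  assumes "finite X" "D \<subseteq> X"
  shows finite_free_pairs: "finite (free_pairs X D)"
    and card_free_pairs: "card (free_pairs X D) = (card X choose 2) + card X - card D"
proof -
  show "finite (free_pairs X D)"
    using assms by (simp add: free_pairs_def finite_two_subsets)
  have "two_subsets X \<inter> (\<lambda>u. {u}) ` (X - D) = {}"
    by (auto simp: two_subsets_def)
  then have "card (free_pairs X D) = card (two_subsets X) + card ((\<lambda>u. {u}) ` (X - D))"
    using assms by (simp add: free_pairs_def finite_two_subsets card_Un_disjoint)
  also have "card ((\<lambda>u. {u}) ` (X - D)) = card X - card D"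
    using assms by (simp add: card_image card_Diff_subset finite_subset)
  \<comment> \<open>Here \<open>card D \<le> card X\<close> is needed to regroup the truncated
    subtraction.\<close>
  finally show "card (free_pairs X D) = (card X choose 2) + card X - card D"
    using assms by (simp add: card_two_subsets card_mono)
qed

lemma new_pairs_subset:
  assumes "g \<in> bin_ops X"
  shows "new_pairs X g \<subseteq> free_pairs X (squares X g)"
proof
  fix A assume A: "A \<in> new_pairs X g"
  then obtain x y where xy: "x \<in> X" "y \<in> X" "A = {g (x, y), g (y, x)}"
    by (auto simp: new_pairs_def value_pairs_def)
  then have "g (x, y) \<in> X" "g (y, x) \<in> X"
    using assms by (auto intro: bin_ops_mem)
  then show "A \<in> free_pairs X (squares X g)"
    using A xy
    by (cases "g (x, y) = g (y, x)") (auto simp: free_pairs_def two_subsets_def new_pairs_def)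
qed

text \<open>Both orders of \<open>x\<close> and \<open>y\<close> give the same value pair, so each
  new pair is determined by a two-element set of arguments.\<close>

lemma card_new_pairs_le:
  assumes "finite X"
  shows "card (new_pairs X g) \<le> card X choose 2"
proof -
  have "new_pairs X g \<subseteq> (\<lambda>A. g ` {(x, y). x \<in> A \<and> y \<in> A \<and> x \<noteq> y}) ` two_subsets X"
  proof
    fix B assume B: "B \<in> new_pairs X g"
    then obtain x y where xy: "x \<in> X" "y \<in> X" "B = {g (x, y), g (y, x)}"
      by (auto simp: new_pairs_def value_pairs_def)
    then have ne: "x \<noteq> y"
      using B by (auto simp: new_pairs_def squares_def)
    have "{(u, v). u \<in> {x, y} \<and> v \<in> {x, y} \<and> u \<noteq> v} = {(x, y), (y, x)}"
      using ne by auto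
    then have "B = g ` {(u, v). u \<in> {x, y} \<and> v \<in> {x, y} \<and> u \<noteq> v}"
      using xy by simp
    moreover have "{x, y} \<in> two_subsets X"
      using xy ne by (simp add: two_subsets_def)
    ultimately show "B \<in> (\<lambda>A. g ` {(x, y). x \<in> A \<and> y \<in> A \<and> x \<noteq> y}) ` two_subsets X"
      by (rule image_eqI)
  qed
  then have "card (new_pairs X g) \<le> card (two_subsets X)"
    by (rule surj_card_le[OF finite_two_subsets[OF assms]])
  then show ?thesis using assms by (simp add: card_two_subsets)
qed

text \<open>An injection \<open>i\<close> assigns to each member of \<open>F\<close> its own
  two-element set of arguments, where it becomes the value pair. The diagonal is left free to
  produce \<open>D\<close>.\<close>

lemma exists_op_with_squares_new_pairs:
  assumes X: "finite X" and D: "D \<subseteq> X" "D \<noteq> {}"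
    and F: "F \<subseteq> free_pairs X D" "card F \<le> card X choose 2"
  shows "\<exists>g \<in> bin_ops X. squares X g = D \<and> new_pairs X g = F"
proof -
  obtain d where d: "d \<in> D" using D by auto
  have finF: "finite F"
    using F finite_free_pairs[OF X D(1)] finite_subset by blast
  obtain i where i: "inj_on i F" "i ` F \<subseteq> two_subsets X"
    using card_le_inj[OF finF finite_two_subsets[OF X]] F(2) card_two_subsets[OF X] by auto
  define p where "p A = (if A \<in> i ` F then inv_into F i A else {d})" for A
  have p_i: "p (i B) = B" if "B \<in> F" for B
    using that i by (simp add: p_def)
  have p_mem: "p A \<in> insert {d} F" for A
    by (auto simp: p_def inv_into_into)
  have "\<exists>u v. u \<in> X \<and> v \<in> X \<and> p A = {u, v}" for A
  proof -
    have "p A \<in> free_pairs X D \<or> p A = {d}"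
      using p_mem[of A] F by auto
    then show ?thesis
    proof
      assume "p A \<in> free_pairs X D"
      then show ?thesis
        unfolding free_pairs_def two_subsets_def card_2_iff by blast
    qed (use d D in auto)
  qed
  then obtain u v where uv: "\<And>A. u A \<in> X \<and> v A \<in> X \<and> p A = {u A, v A}"
    by metis
  define r where "r A = (SOME x. x \<in> A)" for A :: "'a set"
  have r: "r {a, b} = a \<or> r {a, b} = b" for a b
    using someI[of "\<lambda>x. x \<in> {a, b}" a] by (auto simp: r_def)
  \<comment> \<open>The diagonal retracts \<open>X\<close> onto \<open>D\<close>. Off it,
    \<open>r\<close> decides which order of the arguments receives \<open>u\<close> and which
    \<open>v\<close>.\<close>
  define g where "g = (\<lambda>(x, y) \<in> X \<times> X.
    if x = y then (if x \<in> D then x else d)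
    else if r {x, y} = x then u {x, y} else v {x, y})"
  have g: "g \<in> bin_ops X"
    unfolding bin_ops_def g_def
    by (rule restrict_PiE_iff[THEN iffD2]) (use uv d D in \<open>simp add: subset_iff split: prod.split\<close>)
  have sq: "squares X g = D"
    using d D by (auto simp: squares_def g_def image_iff)
  have g_pair: "{g (x, y), g (y, x)} = p {x, y}" if "x \<in> X" "y \<in> X" "x \<noteq> y" for x y
    using that r[of x y] uv[of "{x, y}"] by (auto simp: g_def insert_commute)
  \<comment> \<open>This ensures that removing the singletons of squares from the value pairs of
    \<open>g\<close> loses no member of \<open>F\<close>.\<close>
  have disj: "F \<inter> (\<lambda>d. {d}) ` D = {}"
    using F by (auto simp: free_pairs_def two_subsets_def)
  have "value_pairs X g \<subseteq> F \<union> (\<lambda>d. {d}) ` D"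
  proof
    fix A assume "A \<in> value_pairs X g"
    then obtain x y where xy: "x \<in> X" "y \<in> X" "A = {g (x, y), g (y, x)}"
      by (auto simp: value_pairs_def)
    show "A \<in> F \<union> (\<lambda>d. {d}) ` D"
    proof (cases "x = y")
      case True
      then show ?thesis using xy sq by (auto simp: squares_def)
    next
      case False
      then show ?thesis using xy g_pair p_mem[of "{x, y}"] d by auto
    qed
  qed
  moreover have "F \<subseteq> value_pairs X g"
  proof
    fix B assume B: "B \<in> F"
    then have "i B \<in> two_subsets X"
      using i(2) by blast
    then obtain x y where xy: "x \<noteq> y" "i B = {x, y}" "x \<in> X" "y \<in> X"
      unfolding two_subsets_def card_2_iff by blast
    then have "B = {g (x, y), g (y, x)}"
      using g_pair p_i[OF B] by simp
    then show "B \<in> value_pairs X g"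
      using xy by (auto simp: value_pairs_def)
  qed
  ultimately have "new_pairs X g = F"
    using disj by (auto simp: new_pairs_def sq)
  with g sq show ?thesis by blast
qed

text \<open>The necessary conditions on the invariants are also sufficient. The dependent sum form
  lets the count run over \<open>D\<close> first.\<close>

lemma image_squares_new_pairs:
  assumes "finite X" "X \<noteq> {}"
  shows "(\<lambda>g. (squares X g, new_pairs X g)) ` bin_ops X
    = (SIGMA D : Pow X - {{}}. {F. F \<subseteq> free_pairs X D \<and> card F \<le> card X choose 2})"
    (is "?f ` _ = ?S")
proof
  have "squares X g \<subseteq> X" "squares X g \<noteq> {}" if "g \<in> bin_ops X" for g
    using that assms by (auto simp: squares_def bin_ops_mem)
  then show "?f ` bin_ops X \<subseteq> ?S"
    using assms new_pairs_subset card_new_pairs_le by blast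
  show "?S \<subseteq> ?f ` bin_ops X"
  proof
    fix q assume "q \<in> ?S"
    then obtain D F where q: "q = (D, F)" "D \<subseteq> X" "D \<noteq> {}" "F \<subseteq> free_pairs X D"
      "card F \<le> card X choose 2"
      by blast
    from exists_op_with_squares_new_pairs[OF assms(1) q(2-5)] q(1)
    show "q \<in> ?f ` bin_ops X"
      by (auto simp: image_iff)
  qed
qed

section \<open>Counting\<close>

lemma card_subsets_card_le:
  assumes "finite U"
  shows "card {F. F \<subseteq> U \<and> card F \<le> m} = (\<Sum>k = 0..m. card U choose k)"
proof -
  have "{F. F \<subseteq> U \<and> card F \<le> m} = (\<Union>k\<in>{0..m}. {F. F \<subseteq> U \<and> card F = k})"
    by auto
  also have "card \<dots> = (\<Sum>k = 0..m. card {F. F \<subseteq> U \<and> card F = k})"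
    using assms by (intro card_UN_disjoint) auto
  finally show ?thesis
    using assms by (simp add: n_subsets)
qed

lemma sum_nonempty_subsets_by_card:
  fixes w :: "nat \<Rightarrow> nat"
  assumes "finite X"
  shows "(\<Sum>D\<in>Pow X - {{}}. w (card D)) = (\<Sum>d = 1..card X. (card X choose d) * w d)"
proof -
  have fin: "finite D" if "D \<subseteq> X" for D using that assms finite_subset by blast
  \<comment> \<open>Excluding the empty set makes the index start at 1.\<close>
  have img: "card ` (Pow X - {{}}) \<subseteq> {1..card X}"
    using assms fin by (auto simp: card_mono Suc_le_eq card_gt_0_iff)
  have "(\<Sum>D\<in>Pow X - {{}}. w (card D))
      = (\<Sum>d = 1..card X. \<Sum>D\<in>{D \<in> Pow X - {{}}. card D = d}. w (card D))"
    using sum.group[OF _ _ img, of "\<lambda>D. w (card D)"] assms by simp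
  also have "\<dots> = (\<Sum>d = 1..card X. (card X choose d) * w d)"
  proof (rule sum.cong[OF refl])
    fix d assume "d \<in> {1..card X}"
    then have "{D \<in> Pow X - {{}}. card D = d} = {D. D \<subseteq> X \<and> card D = d}"
      by auto
    then show "(\<Sum>D\<in>{D \<in> Pow X - {{}}. card D = d}. w (card D)) = (card X choose d) * w d"
      using assms by (simp add: n_subsets)
  qed
  finally show ?thesis .
qed

theorem theorem7:
  fixes X :: "'a set" and n N :: nat
  assumes "finite X" and "X \<noteq> {}" and "card X = n" and "N = n choose 2"
  shows "card {principal_left_ideal (op_monoid X) g | g. g \<in> carrier (op_monoid X)}
    = (\<Sum>d = 1..n. (n choose d) * (\<Sum>k = 0..N. (N + n - d) choose k))"
proof -
  let ?f = "\<lambda>g. (squares X g, new_pairs X g)"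
  let ?I = "principal_left_ideal (op_monoid X)"
  let ?F = "\<lambda>D. {F. F \<subseteq> free_pairs X D \<and> card F \<le> N}"
  have "{?I g | g. g \<in> carrier (op_monoid X)} = ?I ` bin_ops X"
    by (auto simp: op_monoid_def)
  moreover have "card (?I ` bin_ops X) = card (?f ` bin_ops X)"
  \<comment> \<open>Ideals and invariant pairs identify the same operations, so sending an ideal to
    the invariants of a chosen generator is a bijection; \<open>key\<close> shows that the choice is
    immaterial.\<close>
  proof (rule bij_betw_same_card)
    show "bij_betw (\<lambda>J. ?f (inv_into (bin_ops X) ?I J)) (?I ` bin_ops X) (?f ` bin_ops X)"
    proof (rule bij_betw_imageI)
      have key: "?f (inv_into (bin_ops X) ?I (?I g)) = ?f g" if "g \<in> bin_ops X" for g
        using that principal_left_ideal_eq_iff[of "inv_into (bin_ops X) ?I (?I g)" X g]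
        by (simp add: f_inv_into_f inv_into_into)
      show "inj_on (\<lambda>J. ?f (inv_into (bin_ops X) ?I J)) (?I ` bin_ops X)"
      proof (rule inj_onI)
        fix J K
        assume "J \<in> ?I ` bin_ops X" "K \<in> ?I ` bin_ops X"
          and eq: "?f (inv_into (bin_ops X) ?I J) = ?f (inv_into (bin_ops X) ?I K)"
        then obtain g h where gh: "g \<in> bin_ops X" "h \<in> bin_ops X" and J: "J = ?I g" and K: "K = ?I h"
          by blast
        from eq have "?f g = ?f h"
          unfolding J K key[OF gh(1)] key[OF gh(2)] .
        then show "J = K"
          unfolding J K principal_left_ideal_eq_iff[OF gh] .
      qed
      show "(\<lambda>J. ?f (inv_into (bin_ops X) ?I J)) ` ?I ` bin_ops X = ?f ` bin_ops X"
        unfolding image_image using key by (intro image_cong) auto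
    qed
  qed
  moreover have "?f ` bin_ops X = (SIGMA D : Pow X - {{}}. ?F D)"
    using image_squares_new_pairs[OF assms(1,2)] assms(3,4) by simp
  moreover have "card (SIGMA D : Pow X - {{}}. ?F D) = (\<Sum>D\<in>Pow X - {{}}. card (?F D))"
    using assms(1) by (intro card_SigmaI) (auto simp: finite_free_pairs)
  moreover have "\<dots> = (\<Sum>D\<in>Pow X - {{}}. \<Sum>k = 0..N. (N + n - card D) choose k)"
    using assms by (intro sum.cong) (auto simp: card_subsets_card_le finite_free_pairs card_free_pairs)
  ultimately show ?thesis
    using sum_nonempty_subsets_by_card[OF assms(1), of "\<lambda>d. \<Sum>k = 0..N. (N + n - d) choose k"]
      assms(3) by simp
qed

end
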